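(* Let $\lambda>-1$ and $t>0$, let $P_n(x)=P_n(x;t)$ be the monic orthogonal polynomials with respect to the weight $w(x;t)=x^{\lambda}e^{-x^3-t/x}$ on $(0,\infty)$, and let $\alpha_n,\beta_n$ be their recurrence coefficients. The monic orthogonal polynomials $P_n(x)$, $n=0,1,2,\ldots$, satisfy the following second-order differential equation: $$P_n''(x)-\left(\mathrm{v}'(x)+\frac{A_{n}'(x)}{A_{n}(x)}\right)P_n'(x)+\left(B_{n}'(x)-B_{n}^2(x)-\mathrm{v}'(x)B_{n}(x)+\beta_{n}A_{n}(x)A_{n-1}(x)-\frac{A_{n}'(x)B_{n}(x)}{A_{n}(x)}\right)P_n(x)=0,$$ where primes denote derivatives with respect to $x$, $$\mathrm{v}'(x)=3x^2-\frac{\lambda}{x}-\frac{t}{x^2},$$ $$A_n(x)=3x+3\alpha_{n}+\frac{R_{n}}{x}+\frac{r_n+r_{n+1}+\alpha_nR_n-\lambda}{x^2},$$ $$B_{n}(x)=3\beta_{n}+\frac{r_n}{x}+\frac{\left(r_n+r_{n+1}+\alpha_nR_n-\lambda\right)\beta_nR_{n-1}+\left(r_{n-1}+r_{n}+\alpha_{n-1}R_{n-1}-\lambda\right)\beta_nR_{n}+tr_n}{(2r_n-\lambda)x^2},$$ with $$R_n:=3\left(\alpha_n^2+\beta_n+\beta_{n+1}\right),\qquad r_n:=3(\alpha_n+\alpha_{n-1})\beta_n-n.$$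
   Context: For $\lambda>-1$, $t>0$ let $w(x;t)=x^{\lambda}e^{-x^3-t/x}$, $x\in(0,\infty)$, with potential $\mathrm{v}(x)=-\ln w(x;t)=x^3-\lambda\ln x+t/x$. Let $P_n(x)=P_n(x;t)$, $n=0,1,2,\dots$, be the monic polynomials of degree $n$ with $\int_0^\infty P_m(x;t)P_n(x;t)w(x;t)\,dx=h_n(t)\delta_{mn}$, $h_n(t)>0$. The recurrence coefficients $\alpha_n=\alpha_n(t)$ and $\beta_n=\beta_n(t)$ are defined by the three-term recurrence relation $xP_n(x;t)=P_{n+1}(x;t)+\alpha_n(t)P_n(x;t)+\beta_n(t)P_{n-1}(x;t)$, with initial conditions $P_0(x;t)=1$ and $\beta_0(t)P_{-1}(x;t)=0$; one has $\alpha_n=\frac1{h_n}\int_0^\infty xP_n^2w\,dx$ and $\beta_n=h_n/h_{n-1}$. In accordance with the initial condition, $\beta_0=0$ and terms containing the factor $\beta_0$ are read as $0$. *)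

theory Defs
  imports "HOL-Analysis.Analysis" "HOL-Computational_Algebra.Polynomial"
begin

definition weight :: "real \<Rightarrow> real \<Rightarrow> real \<Rightarrow> real" where
  "weight lam t x = x powr lam * exp (- (x ^ 3) - t / x)"

definition potential :: "real \<Rightarrow> real \<Rightarrow> real \<Rightarrow> real" where
  "potential lam t x = - ln (weight lam t x)"

definition monic_orthogonal ::
    "(real \<Rightarrow> real) \<Rightarrow> (nat \<Rightarrow> real poly) \<Rightarrow> (nat \<Rightarrow> real) \<Rightarrow> bool" where
  "monic_orthogonal w P h \<longleftrightarrow>
     (\<forall>n. degree (P n) = n \<and> lead_coeff (P n) = 1 \<and> h n > 0) \<and>
     (\<forall>m n. (LBINT x:{0<..}. poly (P m) x * poly (P n) x * w x) = (if m = n then h n else 0))"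

(* On nat, 0 - 1 = 0; hence at n = 0 the symbols of index n - 1, here and below, denote
   the values at index 0.  This is harmless: they occur only multiplied by beta 0 = 0. *)

definition recurrence_coeffs ::
    "(nat \<Rightarrow> real poly) \<Rightarrow> (nat \<Rightarrow> real) \<Rightarrow> (nat \<Rightarrow> real) \<Rightarrow> bool" where
  "recurrence_coeffs P \<alpha> \<beta> \<longleftrightarrow>
     \<beta> 0 = 0 \<and>
     (\<forall>n x. x * poly (P n) x =
        poly (P (n + 1)) x + \<alpha> n * poly (P n) x + \<beta> n * poly (P (n - 1)) x)"

definition R_coeff :: "(nat \<Rightarrow> real) \<Rightarrow> (nat \<Rightarrow> real) \<Rightarrow> nat \<Rightarrow> real" where
  "R_coeff \<alpha> \<beta> n = 3 * ((\<alpha> n)\<^sup>2 + \<beta> n + \<beta> (n + 1))"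

definition r_coeff :: "(nat \<Rightarrow> real) \<Rightarrow> (nat \<Rightarrow> real) \<Rightarrow> nat \<Rightarrow> real" where
  "r_coeff \<alpha> \<beta> n = 3 * (\<alpha> n + \<alpha> (n - 1)) * \<beta> n - real n"

definition A_ladder ::
    "real \<Rightarrow> (nat \<Rightarrow> real) \<Rightarrow> (nat \<Rightarrow> real) \<Rightarrow> nat \<Rightarrow> real \<Rightarrow> real" where
  "A_ladder lam \<alpha> \<beta> n x =
     (let R = R_coeff \<alpha> \<beta>; r = r_coeff \<alpha> \<beta> in
      3 * x + 3 * \<alpha> n + R n / x + (r n + r (n + 1) + \<alpha> n * R n - lam) / x\<^sup>2)"

(* For n = 0 all three numerators vanish, so B_ladder is identically 0; for lam = 0 the last
   quotient is then 0 / 0, which has the intended value 0. *)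

definition B_ladder ::
    "real \<Rightarrow> real \<Rightarrow> (nat \<Rightarrow> real) \<Rightarrow> (nat \<Rightarrow> real) \<Rightarrow> nat \<Rightarrow> real \<Rightarrow> real" where
  "B_ladder lam t \<alpha> \<beta> n x =
     (let R = R_coeff \<alpha> \<beta>; r = r_coeff \<alpha> \<beta> in
      3 * \<beta> n + r n / x +
      ((r n + r (n + 1) + \<alpha> n * R n - lam) * \<beta> n * R (n - 1) +
       (r (n - 1) + r n + \<alpha> (n - 1) * R (n - 1) - lam) * \<beta> n * R n + t * r n)
      / ((2 * r n - lam) * x\<^sup>2))"

end

theory Submission
  imports Defs "HOL-Real_Asymp.Real_Asymp"
begin

text \<open>
  Write \<open>v'\<close> for the derivative of the potential and \<open>v' z - v' y = (z - y) * K z y\<close>; here \<open>K z y\<close> is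
  a combination of \<open>1\<close>, \<open>y\<close>, \<open>1 / y\<close> and \<open>lam / y + t / y\<^sup>2\<close> with coefficients depending on \<open>z\<close>.
  Put \<open>A\<^sub>n z\<close> for the integral of \<open>K z y * P\<^sub>n y ^ 2\<close> against the weight, divided by \<open>h\<^sub>n\<close>, and
  \<open>B\<^sub>n z\<close> for that of \<open>K z y * P\<^sub>n y * P\<^sub>n\<^sub>-\<^sub>1 y\<close>, divided by \<open>h\<^sub>n\<^sub>-\<^sub>1\<close>, with \<open>B\<^sub>0 = 0\<close>.
  Expanding \<open>P\<^sub>n'\<close> in the
  orthogonal basis, integrating by parts and summing with the Christoffel-Darboux formula gives
  \<open>P\<^sub>n' = \<beta>\<^sub>n A\<^sub>n P\<^sub>n\<^sub>-\<^sub>1 - B\<^sub>n P\<^sub>n\<close> (lemma \<open>lowering\<close>). Together with the three-term recurrence this yields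
  the companion formula \<open>P\<^sub>n\<^sub>-\<^sub>1' = (B\<^sub>n + v') P\<^sub>n\<^sub>-\<^sub>1 - A\<^sub>n\<^sub>-\<^sub>1 P\<^sub>n\<close> (lemma \<open>raising\<close>). Differentiating the
  first formula and eliminating \<open>P\<^sub>n\<^sub>-\<^sub>1\<close> is the asserted differential equation.

  It remains to evaluate \<open>A\<^sub>n\<close> and \<open>B\<^sub>n\<close>. All the moments involved obey two difference equations in
  \<open>n\<close>, \<open>cross_sum\<close> and \<open>cross_difference\<close>, which come from the three-term recurrence alone. With
  integration by parts they express every coefficient by \<open>\<alpha>\<close> and \<open>\<beta>\<close>, except for the coefficient \<open>b\<^sub>n\<close> of \<open>1 / z\<^sup>2\<close> in \<open>B\<^sub>n\<close>,
  which is only found to satisfy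
  \<open>(2 r\<^sub>n - lam) b\<^sub>n = t r\<^sub>n + \<beta>\<^sub>n (a\<^sub>n R\<^sub>n\<^sub>-\<^sub>1 + a\<^sub>n\<^sub>-\<^sub>1 R\<^sub>n)\<close> (lemma \<open>b_equation\<close>).

  To divide, one needs \<open>2 r\<^sub>n \<noteq> lam\<close> for \<open>n \<ge> 1\<close> (lemma \<open>two_r_neq_lam\<close>). Jensen's inequality gives
  \<open>a\<^sub>n \<ge> t / \<alpha>\<^sub>n\<close>, and \<open>R\<^sub>n \<ge> 3 \<alpha>\<^sub>n\<^sup>2\<close>; hence the right-hand side above is at least
  \<open>t r\<^sub>n + 3 t \<beta>\<^sub>n (\<alpha>\<^sub>n + \<alpha>\<^sub>n\<^sub>-\<^sub>1) = t (2 r\<^sub>n + n)\<close>. If \<open>2 r\<^sub>n\<close> were equal to \<open>lam\<close>, this lower bound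
  would be \<open>t (lam + n) > 0\<close>, whereas the left-hand side would be \<open>0\<close>. The same two bounds,
  with \<open>\<alpha>\<^sub>n > 0\<close>, show \<open>A\<^sub>n > 0\<close>, so that the divisions by \<open>A\<^sub>n\<close> are legitimate.
\<close>

section \<open>Integration against the weight\<close>

lemma powr_times_exp_tendsto_0:
  fixes s t :: real
  assumes "t > 0"
  shows "((\<lambda>x. x powr s * exp (- (x ^ 3) - t / x)) \<longlongrightarrow> 0) (at_right 0)"
    and "((\<lambda>x. x powr s * exp (- (x ^ 3) - t / x)) \<longlongrightarrow> 0) at_top"
    and "((\<lambda>x. exp x * (x powr s * exp (- (x ^ 3) - t / x))) \<longlongrightarrow> 0) (at_right 0)"
    and "((\<lambda>x. exp x * (x powr s * exp (- (x ^ 3) - t / x))) \<longlongrightarrow> 0) at_top"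
  using assms by real_asymp+

lemma bounded_on_positives:
  fixes f :: "real \<Rightarrow> real"
  assumes cont: "continuous_on {0<..} f"
    and lim0: "(f \<longlongrightarrow> l) (at_right 0)" and lim_top: "(f \<longlongrightarrow> m) at_top"
  obtains C where "\<And>x. x > 0 \<Longrightarrow> \<bar>f x\<bar> \<le> C"
proof -
  have "eventually (\<lambda>x. \<bar>f x\<bar> < \<bar>l\<bar> + 1) (at_right 0)"
    using tendsto_rabs[OF lim0] by (rule order_tendstoD) simp
  then obtain a where a: "a > 0" "\<And>x. 0 < x \<Longrightarrow> x < a \<Longrightarrow> \<bar>f x\<bar> < \<bar>l\<bar> + 1"
    unfolding eventually_at_right_field by auto
  have "eventually (\<lambda>x. \<bar>f x\<bar> < \<bar>m\<bar> + 1) at_top"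
    using tendsto_rabs[OF lim_top] by (rule order_tendstoD) simp
  then obtain b where b: "\<And>x. b \<le> x \<Longrightarrow> \<bar>f x\<bar> < \<bar>m\<bar> + 1"
    unfolding eventually_at_top_linorder by auto
  have "bounded (f ` {a..b})"
    by (intro compact_imp_bounded compact_continuous_image continuous_on_subset[OF cont])
       (use a(1) in auto)
  then obtain D where "\<forall>y\<in>f ` {a..b}. norm y \<le> D"
    unfolding bounded_iff by blast
  then have D: "\<bar>f x\<bar> \<le> D" if "x \<in> {a..b}" for x
    using that by auto
  have "\<bar>f x\<bar> \<le> max D (\<bar>l\<bar> + \<bar>m\<bar> + 1)" if "x > 0" for x
    using a(2)[of x] b[of x] D[of x] that by fastforce
  then show ?thesis by (rule that)
qed

lemma exp_minus_integrable_on_positives: "set_integrable lborel {0<..} (\<lambda>x::real. exp (- x))"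
proof -
  have "set_integrable lborel (einterval (ereal 0) \<infinity>) (\<lambda>x::real. exp (- x))"
  proof (rule interval_integral_FTC_nonneg)
    show "DERIV (\<lambda>x. - exp (- x)) x :> exp (- x)" for x :: real
      by (auto intro!: derivative_eq_intros)
    show "(((\<lambda>x. - exp (- x)) \<circ> real_of_ereal) \<longlongrightarrow> -1) (at_right (ereal 0))"
      unfolding ereal_tendsto_simps1 by (auto intro!: tendsto_eq_intros)
    show "(((\<lambda>x. - exp (- x)) \<circ> real_of_ereal) \<longlongrightarrow> (0::real)) (at_left \<infinity>)"
      unfolding ereal_tendsto_simps1 by real_asymp
  qed auto
  then show ?thesis by simp
qed

text \<open>
  The factor \<open>exp (- (x ^ 3) - t / x)\<close> beats every power at both ends of the half-line, so the
  function is dominated by a multiple of \<open>exp (- x)\<close>.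
\<close>

lemma powr_times_exp_integrable:
  fixes s t :: real
  assumes "t > 0"
  shows "set_integrable lborel {0<..} (\<lambda>x. x powr s * exp (- (x ^ 3) - t / x))"
proof -
  let ?g = "\<lambda>x. exp x * (x powr s * exp (- (x ^ 3) - t / x))"
  have "continuous_on {0<..} ?g"
    by (intro continuous_intros) auto
  from bounded_on_positives[OF this powr_times_exp_tendsto_0(3,4)[OF assms]]
  obtain C where C: "\<And>x. x > 0 \<Longrightarrow> \<bar>?g x\<bar> \<le> C" by blast
  show ?thesis
  proof (rule set_integrable_bound)
    show "set_integrable lborel {0<..} (\<lambda>x. C * exp (- x))"
      using exp_minus_integrable_on_positives by (intro set_integrable_mult_right) auto
    show "set_borel_measurable lborel {0<..} (\<lambda>x. x powr s * exp (- (x ^ 3) - t / x))"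
      unfolding set_borel_measurable_def by measurable
    have "norm (x powr s * exp (- (x ^ 3) - t / x)) \<le> norm (C * exp (- x))" if "x > 0" for x
    proof -
      have "exp (- x) * \<bar>?g x\<bar> \<le> exp (- x) * C"
        using C[OF that] by (intro mult_left_mono) auto
      moreover have "exp (- x) * \<bar>?g x\<bar> = \<bar>x powr s * exp (- (x ^ 3) - t / x)\<bar>"
        by (simp add: abs_mult exp_minus)
      ultimately have "\<bar>x powr s * exp (- (x ^ 3) - t / x)\<bar> \<le> exp (- x) * C"
        by linarith
      then show ?thesis
        by (simp add: mult.commute)
    qed
    then show "AE x in lborel. x \<in> {0<..} \<longrightarrow>
        norm (x powr s * exp (- (x ^ 3) - t / x)) \<le> norm (C * exp (- x))" by auto
  qed
qed

text \<open>
  The exponent \<open>s\<close> is arbitrary so that negative powers are covered, and so that the factor \<open>x\<close> which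
  splits off in the induction can be absorbed.
\<close>

lemma poly_times_powr_exp_integrable:
  fixes s t :: real
  assumes "t > 0"
  shows "set_integrable lborel {0<..} (\<lambda>x. poly p x * (x powr s * exp (- (x ^ 3) - t / x)))"
proof (induction p arbitrary: s)
  case 0
  then show ?case by (simp add: set_integrable_def)
next
  case (pCons a p)
  have "set_integrable lborel {0<..} (\<lambda>x. a * (x powr s * exp (- (x ^ 3) - t / x))
      + poly p x * (x powr (s + 1) * exp (- (x ^ 3) - t / x)))"
    using powr_times_exp_integrable[OF assms] pCons.IH by (intro set_integral_add set_integrable_mult_right)
  then show ?case
    by (rule set_integrable_cong[THEN iffD1, rotated -1]) (auto simp: powr_add algebra_simps)
qed

lemma poly_times_weight_tendsto_0:
  fixes lam t :: real
  assumes "t > 0" and F: "F = at_right 0 \<or> F = at_top"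
  shows "((\<lambda>x. poly p x * weight lam t x) \<longlongrightarrow> 0) F"
proof (induction p arbitrary: lam)
  case 0
  then show ?case by simp
next
  case (pCons a p)
  have "((\<lambda>x. x powr lam * exp (- (x ^ 3) - t / x)) \<longlongrightarrow> 0) F"
    using powr_times_exp_tendsto_0[OF assms(1)] F by blast
  from tendsto_add[OF tendsto_mult_right_zero[OF this, of a] pCons.IH[of "lam + 1"]]
  have lim: "((\<lambda>x. a * weight lam t x + poly p x * weight (lam + 1) t x) \<longlongrightarrow> 0) F"
    by (simp add: weight_def)
  have "eventually (\<lambda>x. x > 0) F"
    using F by (auto simp: eventually_at_right_less eventually_gt_at_top)
  then have "eventually (\<lambda>x. a * weight lam t x + poly p x * weight (lam + 1) t x
      = poly (pCons a p) x * weight lam t x) F"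
    by eventually_elim (auto simp: weight_def powr_add algebra_simps)
  then show ?case
    using lim by (rule Lim_transform_eventually[rotated])
qed

text \<open>
  The functions that get integrated against the weight, regarded on the positive half-line only.
  Negative powers of \<open>x\<close> are harmless at \<open>0\<close> because of the factor \<open>exp (- t / x)\<close>.
\<close>

definition laurent :: "(real \<Rightarrow> real) \<Rightarrow> bool" where
  "laurent f \<longleftrightarrow> (\<exists>p k. \<forall>x>0. f x = poly p x / x ^ k)"

lemma laurent_poly [intro, simp]: "laurent (poly p)"
  unfolding laurent_def by (intro exI[of _ p] exI[of _ 0]) auto

lemma laurent_const [intro, simp]: "laurent (\<lambda>x. c)"
  unfolding laurent_def by (intro exI[of _ "[:c:]"] exI[of _ 0]) auto

lemma laurent_id [intro, simp]: "laurent (\<lambda>x. x)"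
  unfolding laurent_def by (intro exI[of _ "[:0, 1:]"] exI[of _ 0]) auto

lemma laurent_mult [intro, simp]:
  assumes "laurent f" "laurent g"
  shows "laurent (\<lambda>x. f x * g x)"
proof -
  obtain p k q l where "\<forall>x>0. f x = poly p x / x ^ k" "\<forall>x>0. g x = poly q x / x ^ l"
    using assms unfolding laurent_def by blast
  then have "\<forall>x>0. f x * g x = poly (p * q) x / x ^ (k + l)"
    by (auto simp: power_add)
  then show ?thesis unfolding laurent_def by blast
qed

lemma laurent_add [intro, simp]:
  assumes "laurent f" "laurent g"
  shows "laurent (\<lambda>x. f x + g x)"
proof -
  obtain p k q l where "\<forall>x>0. f x = poly p x / x ^ k" "\<forall>x>0. g x = poly q x / x ^ l"
    using assms unfolding laurent_def by blast
  then have "\<forall>x>0. f x + g x = poly (p * monom 1 l + q * monom 1 k) x / x ^ (k + l)"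
    by (auto simp: power_add poly_monom field_simps)
  then show ?thesis unfolding laurent_def by blast
qed

lemma laurent_divide_power [intro, simp]:
  assumes "laurent f"
  shows "laurent (\<lambda>x. f x / x ^ l)"
proof -
  obtain p k where "\<forall>x>0. f x = poly p x / x ^ k"
    using assms unfolding laurent_def by blast
  then have "\<forall>x>0. f x / x ^ l = poly p x / x ^ (k + l)"
    by (auto simp: power_add)
  then show ?thesis unfolding laurent_def by blast
qed

lemma laurent_divide [intro, simp]: "laurent f \<Longrightarrow> laurent (\<lambda>x. f x / x)"
  using laurent_divide_power[of f 1] by simp

lemma laurent_power [intro, simp]: "laurent f \<Longrightarrow> laurent (\<lambda>x. f x ^ n)"
  by (induction n) auto

lemma laurent_diff [intro, simp]:
  assumes "laurent f" "laurent g"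
  shows "laurent (\<lambda>x. f x - g x)"
  using laurent_add[OF assms(1) laurent_mult[OF laurent_const[of "-1"] assms(2)]] by simp

lemma laurent_sum [intro, simp]:
  "(\<And>i. i \<in> S \<Longrightarrow> laurent (f i)) \<Longrightarrow> laurent (\<lambda>x. \<Sum>i\<in>S. f i x)"
  by (induction S rule: infinite_finite_induct) auto

lemma laurent_times_weight_integrable:
  assumes "laurent f" and "t > 0"
  shows "set_integrable lborel {0<..} (\<lambda>x. f x * weight lam t x)"
proof -
  obtain p k where f: "\<And>x. x > 0 \<Longrightarrow> f x = poly p x / x ^ k"
    using assms(1) unfolding laurent_def by blast
  show ?thesis
    using poly_times_powr_exp_integrable[OF assms(2), of p "lam - real k"]
    by (rule set_integrable_cong[THEN iffD1, rotated -1])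
       (auto simp: weight_def f powr_diff powr_realpow)
qed

definition dpotential :: "real \<Rightarrow> real \<Rightarrow> real \<Rightarrow> real" where
  "dpotential lam t x = 3 * x ^ 2 - lam / x - t / x ^ 2"

lemma laurent_dpotential [simp, intro]: "laurent (dpotential lam t)"
  unfolding dpotential_def by (auto intro!: laurent_diff laurent_mult)

lemma weight_eq_exp: "x > 0 \<Longrightarrow> weight lam t x = exp (lam * ln x - x ^ 3 - t / x)"
  by (simp add: weight_def powr_def flip: exp_add)

lemma weight_has_derivative:
  assumes "x > 0"
  shows "(weight lam t has_real_derivative - dpotential lam t x * weight lam t x) (at x)"
proof -
  have "((\<lambda>x. exp (lam * ln x - x ^ 3 - t / x)) has_real_derivative
      - dpotential lam t x * weight lam t x) (at x)"
    using assms
    by (auto intro!: derivative_eq_intros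
        simp: weight_eq_exp dpotential_def power2_eq_square field_simps)
  then show ?thesis
    by (rule has_field_derivative_transform_within_open[of _ _ _ "{0<..}"])
       (use assms in \<open>auto simp: weight_eq_exp\<close>)
qed

lemma deriv_potential:
  assumes "x > 0"
  shows "deriv (potential lam t) x = dpotential lam t x"
proof (rule DERIV_imp_deriv)
  have "weight lam t x > 0"
    using assms by (simp add: weight_def)
  then have "((\<lambda>x. - ln (weight lam t x)) has_real_derivative dpotential lam t x) (at x)"
    by (auto intro!: derivative_eq_intros weight_has_derivative[OF assms])
  then show "(potential lam t has_real_derivative dpotential lam t x) (at x)"
    by (simp add: potential_def[abs_def])
qed

text \<open>
  Integration by parts: \<open>(p * w)' = (p' - p * v') * w\<close>, and \<open>p * w\<close> vanishes at both ends.
\<close>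

lemma integral_pderiv_times_weight:
  assumes "t > 0"
  shows "(LBINT x:{0<..}. poly (pderiv p) x * weight lam t x)
    = (LBINT x:{0<..}. poly p x * dpotential lam t x * weight lam t x)"
proof -
  let ?f = "\<lambda>x. (poly (pderiv p) x - poly p x * dpotential lam t x) * weight lam t x"
  let ?F = "\<lambda>x. poly p x * weight lam t x"
  have int: "set_integrable lborel {0<..} (\<lambda>x. f x * weight lam t x)" if "laurent f" for f
    using that assms by (rule laurent_times_weight_integrable)
  have "(LBINT x=ereal 0..\<infinity>. ?f x) = 0 - 0"
  proof (rule interval_integral_FTC_integrable)
    show "(?F has_vector_derivative ?f x) (at x)" if "ereal 0 < ereal x" for x
      unfolding has_real_derivative_iff_has_vector_derivative[symmetric] using that
      by (auto intro!: derivative_eq_intros weight_has_derivative simp: algebra_simps)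
    show "isCont ?f x" if "ereal 0 < ereal x" for x
      using that DERIV_isCont[OF weight_has_derivative[of x lam t]]
      unfolding dpotential_def by (auto intro!: continuous_intros)
    show "set_integrable lborel (einterval (ereal 0) \<infinity>) ?f"
      using int by simp
    show "((?F \<circ> real_of_ereal) \<longlongrightarrow> 0) (at_right (ereal 0))"
      "((?F \<circ> real_of_ereal) \<longlongrightarrow> 0) (at_left \<infinity>)"
      unfolding ereal_tendsto_simps1 using poly_times_weight_tendsto_0[OF assms] by blast+
  qed auto
  then have "(LBINT x:{0<..}. ?f x) = 0"
    by (simp add: interval_lebesgue_integral_def)
  moreover have "(LBINT x:{0<..}. ?f x) = (LBINT x:{0<..}. poly (pderiv p) x * weight lam t x)
      - (LBINT x:{0<..}. poly p x * dpotential lam t x * weight lam t x)"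
    unfolding left_diff_distrib by (intro set_integral_diff int) auto
  ultimately show ?thesis by simp
qed

section \<open>Moments with respect to products of orthogonal polynomials\<close>

locale semi_classical_polys =
  fixes lam t :: real and P :: "nat \<Rightarrow> real poly" and h \<alpha> \<beta> :: "nat \<Rightarrow> real"
  assumes lam: "lam > -1" and t_pos: "t > 0"
    and orth: "monic_orthogonal (weight lam t) P h"
    and rec: "recurrence_coeffs P \<alpha> \<beta>"
begin

definition L :: "(real \<Rightarrow> real) \<Rightarrow> real" where
  "L f = (LBINT y:{0<..}. f y * weight lam t y)"

lemma L_cong: "(\<And>y. y > 0 \<Longrightarrow> f y = g y) \<Longrightarrow> L f = L g"
  unfolding L_def by (intro set_lebesgue_integral_cong) auto

lemma L_add:
  assumes "laurent f" "laurent g"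
  shows "L (\<lambda>y. f y + g y) = L f + L g"
  using assms t_pos unfolding L_def distrib_right
  by (intro set_integral_add laurent_times_weight_integrable)

lemma L_cmult: "L (\<lambda>y. c * f y) = c * L f"
  unfolding L_def mult.assoc by simp

lemma L_diff:
  assumes "laurent f" "laurent g"
  shows "L (\<lambda>y. f y - g y) = L f - L g"
  using assms t_pos unfolding L_def left_diff_distrib
  by (intro set_integral_diff laurent_times_weight_integrable)

lemma L_zero: "L (\<lambda>y. 0) = 0"
  using L_cmult[of 0 "\<lambda>y. 0"] by simp

lemma L_sum:
  assumes "\<And>i. i \<in> S \<Longrightarrow> laurent (f i)"
  shows "L (\<lambda>y. \<Sum>i\<in>S. f i y) = (\<Sum>i\<in>S. L (f i))"
  using assms
proof (induction S rule: infinite_finite_induct)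
  case (insert i S)
  then show ?case by (simp add: L_add laurent_sum)
qed (simp_all add: L_zero)

lemma L_nonneg: "(\<And>y. y > 0 \<Longrightarrow> f y \<ge> 0) \<Longrightarrow> L f \<ge> 0"
  unfolding L_def set_lebesgue_integral_def
  by (intro Bochner_Integration.integral_nonneg) (auto simp: weight_def indicator_def)

lemma h_pos: "h n > 0"
  and degree_P: "degree (P n) = n"
  and lead_coeff_P: "coeff (P n) n = 1"
  using orth unfolding monic_orthogonal_def by (metis+)

lemma L_P_P: "L (\<lambda>y. poly (P m) y * poly (P n) y) = (if m = n then h n else 0)"
  using orth unfolding monic_orthogonal_def L_def by blast

lemma beta_0: "\<beta> 0 = 0"
  and recurrence: "y * poly (P n) y
    = poly (P (Suc n)) y + \<alpha> n * poly (P n) y + \<beta> n * poly (P (n - 1)) y"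
  using rec unfolding recurrence_coeffs_def by auto

definition inner :: "nat \<Rightarrow> nat \<Rightarrow> (real \<Rightarrow> real) \<Rightarrow> real" where
  "inner m n g = L (\<lambda>y. poly (P m) y * poly (P n) y * g y)"

lemma inner_commute: "inner m n g = inner n m g"
  unfolding inner_def by (simp add: mult.commute)

lemma inner_cong: "(\<And>y. y > 0 \<Longrightarrow> f y = g y) \<Longrightarrow> inner m n f = inner m n g"
  unfolding inner_def by (rule L_cong) simp

lemma inner_add:
  "laurent f \<Longrightarrow> laurent g \<Longrightarrow> inner m n (\<lambda>y. f y + g y) = inner m n f + inner m n g"
  unfolding inner_def distrib_left by (intro L_add laurent_mult laurent_poly)

lemma inner_cmult: "inner m n (\<lambda>y. c * f y) = c * inner m n f"
  unfolding inner_def mult.left_commute[of _ c] by (rule L_cmult)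

lemma inner_one: "inner m n (\<lambda>y. 1) = (if m = n then h n else 0)"
  unfolding inner_def by (simp add: L_P_P)

lemma inner_recurrence:
  assumes "laurent g"
  shows "inner m n (\<lambda>y. y * g y)
    = inner m (Suc n) g + \<alpha> n * inner m n g + \<beta> n * inner m (n - 1) g"
proof -
  have "inner m n (\<lambda>y. y * g y) = L (\<lambda>y. poly (P m) y * (y * poly (P n) y) * g y)"
    unfolding inner_def by (rule L_cong) (simp add: mult_ac)
  also have "\<dots> = L (\<lambda>y. (poly (P m) y * poly (P (Suc n)) y * g y
      + \<alpha> n * (poly (P m) y * poly (P n) y * g y))
      + \<beta> n * (poly (P m) y * poly (P (n - 1)) y * g y))"
    unfolding recurrence by (rule L_cong) (simp add: algebra_simps)
  also have "\<dots> = inner m (Suc n) g + \<alpha> n * inner m n g + \<beta> n * inner m (n - 1) g"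
    using assms by (simp add: L_add L_cmult inner_def)
  finally show ?thesis .
qed

text \<open>
  Evaluate the integral of \<open>y * P\<^sub>n y * P\<^sub>n\<^sub>+\<^sub>1 y\<close> by applying the recurrence to either factor.
\<close>

lemma beta_Suc_h: "\<beta> (Suc n) * h n = h (Suc n)"
proof -
  have "inner (Suc n) n (\<lambda>y. y * 1) = h (Suc n)"
    unfolding inner_recurrence[OF laurent_const] inner_one by simp
  moreover have "inner n (Suc n) (\<lambda>y. y * 1) = \<beta> (Suc n) * h n"
    unfolding inner_recurrence[OF laurent_const] inner_one by simp
  ultimately show ?thesis by (simp add: inner_commute)
qed

lemma beta_pos: "n > 0 \<Longrightarrow> \<beta> n > 0"
  using beta_Suc_h[of "n - 1"] h_pos[of n] h_pos[of "n - 1"]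
  by (cases n) (auto simp: zero_less_mult_iff simp flip: beta_Suc_h)

text \<open>
  All coefficients below are normalised moments of these two kinds. The factor \<open>\<beta> n / h n\<close> is
  \<open>1 / h (n - 1)\<close> for positive \<open>n\<close> and \<open>0\<close> for \<open>n = 0\<close>; with it, the difference equations below
  hold from \<open>n = 0\<close> on.
\<close>

definition mean :: "(real \<Rightarrow> real) \<Rightarrow> nat \<Rightarrow> real" where
  "mean g n = inner n n g / h n"

definition cross :: "(real \<Rightarrow> real) \<Rightarrow> nat \<Rightarrow> real" where
  "cross g n = \<beta> n * inner n (n - 1) g / h n"

lemma cross_Suc: "cross g (Suc n) = inner (Suc n) n g / h n"
proof -
  have "\<beta> (Suc n) \<noteq> 0" using beta_pos[of "Suc n"] by simp
  then show ?thesis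
    unfolding cross_def beta_Suc_h[of n, symmetric] by simp
qed

lemma cross_0: "cross g 0 = 0"
  by (simp add: cross_def beta_0)

lemma mean_cong: "(\<And>y. y > 0 \<Longrightarrow> f y = g y) \<Longrightarrow> mean f n = mean g n"
  and cross_cong: "(\<And>y. y > 0 \<Longrightarrow> f y = g y) \<Longrightarrow> cross f n = cross g n"
  unfolding mean_def cross_def by (simp_all cong: inner_cong)

lemma mean_add: "laurent f \<Longrightarrow> laurent g \<Longrightarrow> mean (\<lambda>y. f y + g y) n = mean f n + mean g n"
  and cross_add: "laurent f \<Longrightarrow> laurent g \<Longrightarrow> cross (\<lambda>y. f y + g y) n = cross f n + cross g n"
  unfolding mean_def cross_def by (simp_all add: inner_add algebra_simps add_divide_distrib)

lemma mean_cmult: "mean (\<lambda>y. c * f y) n = c * mean f n"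
  and cross_cmult: "cross (\<lambda>y. c * f y) n = c * cross f n"
  unfolding mean_def cross_def by (simp_all add: inner_cmult)

lemma mean_const: "mean (\<lambda>y. c) n = c"
  and cross_const: "cross (\<lambda>y. c) n = 0"
proof -
  show "mean (\<lambda>y. c) n = c"
    using mean_cmult[of c "\<lambda>y. 1" n] h_pos[of n] by (simp add: mean_def inner_one)
  have "cross (\<lambda>y. 1) n = 0"
    by (cases n) (simp_all add: cross_0 cross_Suc inner_one)
  then show "cross (\<lambda>y. c) n = 0"
    using cross_cmult[of c "\<lambda>y. 1" n] by simp
qed

text \<open>
  The left-hand side pairs \<open>P\<^sub>n\<close> with \<open>P\<^sub>n\<^sub>+\<^sub>1 + \<beta>\<^sub>n P\<^sub>n\<^sub>-\<^sub>1\<close>, which is \<open>(y - \<alpha>\<^sub>n) P\<^sub>n\<close>.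
\<close>

lemma cross_sum:
  assumes "laurent g"
  shows "cross g (Suc n) + cross g n = mean (\<lambda>y. y * g y) n - \<alpha> n * mean g n"
  unfolding cross_Suc unfolding cross_def mean_def inner_recurrence[OF assms] inner_commute[of n "Suc n"]
  by (simp add: add_divide_distrib)

text \<open>
  Multiply \<open>P\<^sub>n\<close> by \<open>y\<close> via the recurrence in both terms on the left; the moments of
  \<open>P\<^sub>n\<^sub>+\<^sub>1 P\<^sub>n\<^sub>-\<^sub>1\<close> that arise are the same and cancel.
\<close>

lemma cross_difference:
  assumes "laurent g"
  shows "cross (\<lambda>y. y * g y) (Suc n) - cross (\<lambda>y. y * g y) n
    = \<alpha> n * (cross g (Suc n) - cross g n) + \<beta> (Suc n) * mean g (Suc n) - \<beta> n * mean g (n - 1)"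
proof -
  have h: "h n \<noteq> 0" "h (Suc n) \<noteq> 0" "h (n - 1) \<noteq> 0"
    using h_pos by (metis less_irrefl)+
  have "cross (\<lambda>y. y * g y) (Suc n) = (inner (Suc n) (Suc n) g
      + \<alpha> n * inner (Suc n) n g + \<beta> n * inner (Suc n) (n - 1) g) / h n"
    unfolding cross_Suc inner_recurrence[OF assms] ..
  also have "inner (Suc n) (Suc n) g / h n = \<beta> (Suc n) * mean g (Suc n)"
    using h by (simp add: mean_def field_simps flip: beta_Suc_h)
  moreover have "\<beta> n * (\<beta> n * inner (n - 1) (n - 1) g) / h n = \<beta> n * mean g (n - 1)"
    using h by (cases n) (simp_all add: beta_0 mean_def flip: beta_Suc_h)
  moreover have "cross (\<lambda>y. y * g y) n = \<beta> n * (inner (Suc n) (n - 1) g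
      + \<alpha> n * inner n (n - 1) g + \<beta> n * inner (n - 1) (n - 1) g) / h n"
    unfolding cross_def inner_commute[of n "n - 1" "\<lambda>y. y * g y"] inner_recurrence[OF assms, of "n - 1" n]
    by (simp only: inner_commute[of "n - 1" "Suc n"] inner_commute[of "n - 1" n])
  ultimately show ?thesis
    unfolding cross_Suc[of g] unfolding cross_def[of g]
    by (simp add: add_divide_distrib algebra_simps)
qed

text \<open>
  The moments of \<open>y\<close> and \<open>y\<^sup>2\<close> follow by applying the two difference equations to \<open>g = 1\<close> and
  \<open>g = y\<close>; the induction starts because \<open>cross\<close> vanishes at \<open>0\<close>.
\<close>

lemma mean_id: "mean (\<lambda>y. y) n = \<alpha> n"
  using cross_sum[OF laurent_const[of 1], of n] by (simp add: mean_const cross_const)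

lemma cross_id: "cross (\<lambda>y. y) n = \<beta> n"
proof (induction n)
  case (Suc n)
  then show ?case
    using cross_difference[OF laurent_const[of 1], of n] by (simp add: mean_const cross_const)
qed (simp add: cross_0 beta_0)

lemma mean_square: "mean (\<lambda>y. y\<^sup>2) n = (\<alpha> n)\<^sup>2 + \<beta> n + \<beta> (Suc n)"
  using cross_sum[OF laurent_id, of n] by (simp add: mean_id cross_id power2_eq_square)

lemma cross_square: "cross (\<lambda>y. y\<^sup>2) n = (\<alpha> n + \<alpha> (n - 1)) * \<beta> n"
proof (induction n)
  case (Suc n)
  then show ?case
    using cross_difference[OF laurent_id, of n]
    by (simp add: mean_id cross_id power2_eq_square algebra_simps)
qed (simp add: cross_0 beta_0)

text \<open>
  The hypothesis says \<open>degree q < n\<close>, in a form that leaves \<open>q = 0\<close> as the only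
  possibility for \<open>n = 0\<close>.
\<close>

lemma expansion_in_P:
  assumes "\<And>i. i \<ge> n \<Longrightarrow> coeff q i = 0"
  obtains c where "q = (\<Sum>k<n. smult (c k) (P k))"
  using assms
proof (induction n arbitrary: q thesis)
  case 0
  then show ?case by (metis bot_nat_0.extremum lessThan_0 poly_eqI coeff_0 sum.empty)
next
  case (Suc n)
  let ?q = "q - smult (coeff q n) (P n)"
  have "coeff ?q i = 0" if "i \<ge> n" for i
  proof (cases "i = n")
    case True
    then show ?thesis by (simp add: lead_coeff_P)
  next
    case False
    then have "coeff q i = 0" "coeff (P n) i = 0"
      using that Suc.prems(2) degree_P[of n] by (auto intro: coeff_eq_0)
    then show ?thesis by simp
  qed
  then obtain c where c: "?q = (\<Sum>k<n. smult (c k) (P k))"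
    using Suc.IH by blast
  have "q = (\<Sum>k<Suc n. smult ((c(n := coeff q n)) k) (P k))"
    using c by (simp add: algebra_simps)
  then show ?case by (rule Suc.prems(1))
qed

lemma reproducing:
  assumes "\<And>i. i \<ge> n \<Longrightarrow> coeff q i = 0"
  shows "poly q z = (\<Sum>k<n. L (\<lambda>y. poly q y * poly (P k) y) / h k * poly (P k) z)"
    and "m \<ge> n \<Longrightarrow> L (\<lambda>y. poly q y * poly (P m) y) = 0"
proof -
  obtain c where q: "q = (\<Sum>k<n. smult (c k) (P k))"
    using assms by (rule expansion_in_P)
  have L: "L (\<lambda>y. poly q y * poly (P m) y) = (\<Sum>k<n. c k * (if k = m then h m else 0))" for m
  proof -
    have "L (\<lambda>y. poly q y * poly (P m) y) = L (\<lambda>y. \<Sum>k<n. c k * (poly (P k) y * poly (P m) y))"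
      by (rule L_cong) (simp add: q poly_sum sum_distrib_right mult.assoc)
    also have "\<dots> = (\<Sum>k<n. c k * (if k = m then h m else 0))"
      by (subst L_sum) (auto simp: L_cmult L_P_P)
    finally show ?thesis .
  qed
  show "m \<ge> n \<Longrightarrow> L (\<lambda>y. poly q y * poly (P m) y) = 0"
    unfolding L by (intro sum.neutral) auto
  have "L (\<lambda>y. poly q y * poly (P k) y) / h k = c k" if "k < n" for k
    using that h_pos[of k] by (simp add: L if_distrib cong: if_cong)
  then show "poly q z = (\<Sum>k<n. L (\<lambda>y. poly q y * poly (P k) y) / h k * poly (P k) z)"
    by (simp add: q poly_sum)
qed

lemma coeff_P_eq_0: "i > n \<Longrightarrow> coeff (P n) i = 0"
  using degree_P[of n] by (auto intro: coeff_eq_0)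

lemma L_pderiv_P_orthogonal: "k \<le> n \<Longrightarrow> L (\<lambda>y. poly (pderiv (P k)) y * poly (P n) y) = 0"
  by (rule reproducing(2)[of k]) (auto simp: coeff_pderiv coeff_P_eq_0)

lemma L_pderiv_P_Suc: "L (\<lambda>y. poly (pderiv (P (Suc n))) y * poly (P n) y) = (real n + 1) * h n"
proof -
  let ?q = "pderiv (P (Suc n)) - smult (real n + 1) (P n)"
  have "L (\<lambda>y. poly ?q y * poly (P n) y) = 0"
  proof (rule reproducing(2)[of n])
    fix i assume "i \<ge> n"
    then show "coeff ?q i = 0"
      by (cases "i = n") (auto simp: coeff_pderiv coeff_P_eq_0 lead_coeff_P)
  qed simp
  then have "L (\<lambda>y. poly (pderiv (P (Suc n))) y * poly (P n) y
      - (real n + 1) * (poly (P n) y * poly (P n) y)) = 0"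
    by (simp add: algebra_simps)
  then show ?thesis
    by (subst (asm) L_diff) (auto simp: L_cmult L_P_P intro!: laurent_mult)
qed

text \<open>
  Integration by parts; in the diagonal and subdiagonal cases, orthogonality then leaves at most the
  leading coefficient of \<open>P\<^sub>n'\<close>.
\<close>

lemma inner_dpotential:
  "inner m n (dpotential lam t) = L (\<lambda>y. poly (pderiv (P m)) y * poly (P n) y)
    + L (\<lambda>y. poly (pderiv (P n)) y * poly (P m) y)"
proof -
  have "inner m n (dpotential lam t) = L (poly (pderiv (P m * P n)))"
    using integral_pderiv_times_weight[OF t_pos, of "P m * P n" lam]
    by (simp add: inner_def L_def)
  also have "\<dots> = L (\<lambda>y. poly (pderiv (P m)) y * poly (P n) y + poly (pderiv (P n)) y * poly (P m) y)"
    by (rule L_cong) (simp add: pderiv_mult algebra_simps)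
  finally show ?thesis
    by (simp add: L_add)
qed

lemma mean_dpotential: "mean (dpotential lam t) n = 0"
  by (simp add: mean_def inner_dpotential L_pderiv_P_orthogonal)

lemma cross_dpotential: "cross (dpotential lam t) n = real n"
  using h_pos[of "n - 1"]
  by (cases n) (auto simp: cross_0 cross_Suc inner_dpotential L_pderiv_P_orthogonal L_pderiv_P_Suc)

section \<open>Ladder operators\<close>

lemma christoffel_darboux:
  "(z - y) * (\<Sum>k<n. poly (P k) z * poly (P k) y / h k)
    = \<beta> n / h n * (poly (P n) z * poly (P (n - 1)) y - poly (P (n - 1)) z * poly (P n) y)"
proof (induction n)
  case (Suc n)
  have "h n \<noteq> 0" "\<beta> (Suc n) \<noteq> 0"
    using h_pos[of n] beta_pos[of "Suc n"] by auto
  then have b: "\<beta> (Suc n) / h (Suc n) = 1 / h n"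
    by (simp flip: beta_Suc_h)
  have "(z - y) * (poly (P n) z * poly (P n) y)
      = (z * poly (P n) z) * poly (P n) y - poly (P n) z * (y * poly (P n) y)"
    by (simp add: algebra_simps)
  also have "\<dots> = poly (P (Suc n)) z * poly (P n) y - poly (P n) z * poly (P (Suc n)) y
      - \<beta> n * (poly (P n) z * poly (P (n - 1)) y - poly (P (n - 1)) z * poly (P n) y)"
    unfolding recurrence by (simp add: algebra_simps)
  finally have step: "(z - y) * (poly (P n) z * poly (P n) y / h n)
      = (poly (P (Suc n)) z * poly (P n) y - poly (P n) z * poly (P (Suc n)) y) / h n
      - \<beta> n / h n * (poly (P n) z * poly (P (n - 1)) y - poly (P (n - 1)) z * poly (P n) y)"
    by (simp add: diff_divide_distrib)
  show ?case
    using Suc.IH step by (simp add: b distrib_left)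
qed (simp add: beta_0)

text \<open>
  The part of \<open>- v'\<close> that is singular at \<open>0\<close>.
\<close>

definition sing :: "real \<Rightarrow> real" where
  "sing y = lam / y + t / y ^ 2"

lemma laurent_sing [simp, intro]: "laurent sing"
  unfolding sing_def by (intro laurent_add laurent_divide laurent_divide_power laurent_const)

text \<open>
  The divided difference of \<open>v'\<close>, grouped by the functions of \<open>y\<close> whose moments are needed.
\<close>

definition kernel :: "real \<Rightarrow> real \<Rightarrow> real" where
  "kernel z y = 3 * z + 3 * y + 1 / z * sing y + t / z ^ 2 * (1 / y)"

lemma laurent_kernel [simp, intro]: "laurent (kernel z)"
  unfolding kernel_def by (intro laurent_add laurent_mult) auto

lemma kernel_eq_divided_difference:
  assumes "z > 0" "y > 0"
  shows "(z - y) * kernel z y = dpotential lam t z - dpotential lam t y"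
  using assms unfolding kernel_def sing_def dpotential_def
  by (simp add: field_simps power2_eq_square)

text \<open>
  The coefficients of the powers of \<open>1 / z\<close> in the two moments of the kernel. Their values in terms
  of \<open>\<alpha>\<close> and \<open>\<beta>\<close> are determined below.
\<close>

definition R where "R n = mean sing n"
definition r where "r n = cross sing n"
definition a where "a n = t * mean (\<lambda>y. 1 / y) n"
definition b where "b n = t * cross (\<lambda>y. 1 / y) n"

lemma kernel_mean: "mean (kernel z) n = 3 * z + 3 * \<alpha> n + R n / z + a n / z ^ 2"
  and kernel_cross: "cross (kernel z) n = 3 * \<beta> n + r n / z + b n / z ^ 2"
proof -
  have l: "laurent (\<lambda>y. 3 * z)" "laurent (\<lambda>y. 3 * y)" "laurent (\<lambda>y. 1 / z * sing y)"
    "laurent (\<lambda>y. t / z ^ 2 * (1 / y))"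
    by (intro laurent_mult laurent_divide laurent_const laurent_id laurent_sing)+
  show "mean (kernel z) n = 3 * z + 3 * \<alpha> n + R n / z + a n / z ^ 2"
    unfolding kernel_def
    by (simp only: mean_add laurent_add l mean_cmult mean_const mean_id)
       (simp add: R_def a_def)
  show "cross (kernel z) n = 3 * \<beta> n + r n / z + b n / z ^ 2"
    unfolding kernel_def
    by (simp only: cross_add laurent_add l cross_cmult cross_const cross_id)
       (simp add: r_def b_def)
qed

text \<open>
  By orthogonality, the coefficient of \<open>P\<^sub>k\<close> in \<open>P\<^sub>n'\<close>, for \<open>k < n\<close>, does not change when \<open>v' y\<close> is
  replaced by \<open>v' y - v' z\<close> after the integration by parts. That difference contains the factor
  \<open>z - y\<close>, which is what the Christoffel-Darboux sum asks for.
\<close>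

lemma lowering:
  assumes z: "z > 0"
  shows "poly (pderiv (P n)) z
    = \<beta> n * mean (kernel z) n * poly (P (n - 1)) z - cross (kernel z) n * poly (P n) z"
proof -
  let ?d = "\<lambda>y. dpotential lam t y - dpotential lam t z"
  have coef: "L (\<lambda>y. poly (pderiv (P n)) y * poly (P k) y) = inner n k ?d" if "k < n" for k
  proof -
    have "inner n k ?d = inner n k (\<lambda>y. dpotential lam t y + (- dpotential lam t z) * 1)"
      by simp
    also have "\<dots> = inner n k (dpotential lam t) + (- dpotential lam t z) * inner n k (\<lambda>y. 1)"
      by (subst inner_add) (auto simp only: laurent_dpotential laurent_const inner_cmult laurent_mult)
    finally show ?thesis
      using that by (simp add: inner_dpotential inner_one L_pderiv_P_orthogonal)
  qed
  have "poly (pderiv (P n)) z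
      = (\<Sum>k<n. L (\<lambda>y. poly (pderiv (P n)) y * poly (P k) y) / h k * poly (P k) z)"
    by (rule reproducing) (auto simp: coeff_pderiv coeff_P_eq_0)
  also have "\<dots> = (\<Sum>k<n. L (\<lambda>y. poly (P k) z / h k * (poly (P n) y * poly (P k) y * ?d y)))"
    unfolding L_cmult by (intro sum.cong) (auto simp: coef inner_def)
  also have "\<dots> = L (\<lambda>y. \<Sum>k<n. poly (P k) z / h k * (poly (P n) y * poly (P k) y * ?d y))"
    by (intro L_sum[symmetric] laurent_mult laurent_diff laurent_const laurent_poly
        laurent_dpotential)
  also have "\<dots> = L (\<lambda>y. \<beta> n / h n * poly (P (n - 1)) z * (poly (P n) y * poly (P n) y * kernel z y)
      - \<beta> n / h n * poly (P n) z * (poly (P n) y * poly (P (n - 1)) y * kernel z y))"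
  proof (rule L_cong)
    fix y :: real assume y: "y > 0"
    have "(\<Sum>k<n. poly (P k) z / h k * (poly (P n) y * poly (P k) y * ?d y))
        = ?d y * poly (P n) y * (\<Sum>k<n. poly (P k) z * poly (P k) y / h k)"
      unfolding sum_distrib_left by (rule sum.cong) simp_all
    also have "\<dots> = - ((z - y) * kernel z y) * poly (P n) y * (\<Sum>k<n. poly (P k) z * poly (P k) y / h k)"
      using kernel_eq_divided_difference[OF z y] by simp
    also have "\<dots> = - (kernel z y * poly (P n) y * ((z - y) * (\<Sum>k<n. poly (P k) z * poly (P k) y / h k)))"
      by simp
    also have "\<dots> = \<beta> n / h n * poly (P (n - 1)) z * (poly (P n) y * poly (P n) y * kernel z y)
        - \<beta> n / h n * poly (P n) z * (poly (P n) y * poly (P (n - 1)) y * kernel z y)"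
      unfolding christoffel_darboux by (simp add: algebra_simps)
    finally show "(\<Sum>k<n. poly (P k) z / h k * (poly (P n) y * poly (P k) y * ?d y))
        = \<beta> n / h n * poly (P (n - 1)) z * (poly (P n) y * poly (P n) y * kernel z y)
        - \<beta> n / h n * poly (P n) z * (poly (P n) y * poly (P (n - 1)) y * kernel z y)" .
  qed
  also have "\<dots> = \<beta> n / h n * poly (P (n - 1)) z * inner n n (kernel z)
      - \<beta> n / h n * poly (P n) z * inner n (n - 1) (kernel z)"
    by (simp only: L_diff L_cmult inner_def laurent_mult laurent_const laurent_poly laurent_kernel)
  finally show ?thesis
    by (simp add: mean_def cross_def mult_ac)
qed

text \<open>
  This is \<open>cross_sum\<close> for the kernel: \<open>y * K z y\<close> is \<open>z * K z y\<close> minus the difference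
  \<open>v' z - v' y\<close>, and \<open>v' y\<close> has mean \<open>0\<close>.
\<close>

lemma kernel_cross_sum:
  assumes z: "z > 0"
  shows "cross (kernel z) (Suc n) + cross (kernel z) n
    = (z - \<alpha> n) * mean (kernel z) n - dpotential lam t z"
proof -
  have "mean (\<lambda>y. y * kernel z y) n
      = mean (\<lambda>y. z * kernel z y + (dpotential lam t y + (- dpotential lam t z))) n"
    by (rule mean_cong) (use kernel_eq_divided_difference[OF z] in \<open>simp add: algebra_simps\<close>)
  also have "\<dots> = z * mean (kernel z) n - dpotential lam t z"
    by (simp add: mean_add mean_cmult mean_const mean_dpotential del: add_uminus_conv_diff)
  finally show ?thesis
    using cross_sum[OF laurent_kernel, of z n] by (simp add: algebra_simps)
qed

text \<open>
  The lowering formula for \<open>P\<^sub>n\<^sub>-\<^sub>1\<close>, with \<open>P\<^sub>n\<^sub>-\<^sub>2\<close> eliminated by the recurrence.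
\<close>

lemma raising:
  assumes z: "z > 0" and n: "n > 0"
  shows "poly (pderiv (P (n - 1))) z
    = (cross (kernel z) n + dpotential lam t z) * poly (P (n - 1)) z
      - mean (kernel z) (n - 1) * poly (P n) z"
proof -
  obtain m where n: "n = Suc m" using n by (cases n) auto
  have "\<beta> m * poly (P (m - 1)) z = (z - \<alpha> m) * poly (P m) z - poly (P (Suc m)) z"
    using recurrence[of z m] by (simp add: algebra_simps)
  then have "\<beta> m * mean (kernel z) m * poly (P (m - 1)) z
      = mean (kernel z) m * ((z - \<alpha> m) * poly (P m) z - poly (P (Suc m)) z)"
    by (simp add: mult_ac)
  then have "poly (pderiv (P m)) z
      = mean (kernel z) m * ((z - \<alpha> m) * poly (P m) z - poly (P (Suc m)) z)
        - cross (kernel z) m * poly (P m) z"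
    using lowering[OF z, of m] by simp
  also have "\<dots> = ((z - \<alpha> m) * mean (kernel z) m - cross (kernel z) m) * poly (P m) z
        - mean (kernel z) m * poly (P (Suc m)) z"
    by (simp add: algebra_simps)
  also have "(z - \<alpha> m) * mean (kernel z) m - cross (kernel z) m
      = cross (kernel z) (Suc m) + dpotential lam t z"
    using kernel_cross_sum[OF z, of m] by simp
  finally show ?thesis
    by (simp add: n)
qed

section \<open>The coefficients of the ladder operators\<close>

text \<open>
  Multiplication by \<open>y\<close> turns the singular part into \<open>lam + t / y\<close>. This links the moments \<open>R, r\<close>
  with \<open>a, b\<close>.
\<close>

lemma mean_inverse_shift: "mean (\<lambda>y. y * sing y) n = lam + a n"
  and cross_inverse_shift: "cross (\<lambda>y. y * sing y) n = b n"
proof -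
  have *: "y * sing y = lam + t * (1 / y)" if "y > 0" for y
    using that by (simp add: sing_def field_simps power2_eq_square)
  have "mean (\<lambda>y. y * sing y) n = mean (\<lambda>y. lam + t * (1 / y)) n"
    by (rule mean_cong) (rule *)
  then show "mean (\<lambda>y. y * sing y) n = lam + a n"
    by (simp only: mean_add laurent_const laurent_mult laurent_divide mean_cmult mean_const a_def)
  have "cross (\<lambda>y. y * sing y) n = cross (\<lambda>y. lam + t * (1 / y)) n"
    by (rule cross_cong) (rule *)
  then show "cross (\<lambda>y. y * sing y) n = b n"
    by (simp only: cross_add laurent_const laurent_mult laurent_divide cross_cmult cross_const b_def)
qed

lemma r_sum: "r (Suc n) + r n = lam + a n - \<alpha> n * R n"
  using cross_sum[OF laurent_sing, of n] by (simp add: r_def R_def mean_inverse_shift)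

lemma r_difference:
  "b (Suc n) - b n = \<alpha> n * (r (Suc n) - r n) + \<beta> (Suc n) * R (Suc n) - \<beta> n * R (n - 1)"
  using cross_difference[OF laurent_sing, of n] by (simp add: r_def R_def cross_inverse_shift)

lemma b_sum: "b (Suc n) + b n = t - \<alpha> n * a n"
proof -
  have "mean (\<lambda>y. y * (1 / y)) n = 1"
    using mean_cong[of "\<lambda>y. y * (1 / y)" "\<lambda>y. 1" n] by (simp add: mean_const)
  then have "t * (cross (\<lambda>y. 1 / y) (Suc n) + cross (\<lambda>y. 1 / y) n)
      = t * (1 - \<alpha> n * mean (\<lambda>y. 1 / y) n)"
    using cross_sum[OF laurent_divide[OF laurent_const], of 1 n] by simp
  then show ?thesis
    unfolding a_def b_def by (simp add: algebra_simps)
qed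

lemma b_difference:
  "0 = \<alpha> n * (b (Suc n) - b n) + \<beta> (Suc n) * a (Suc n) - \<beta> n * a (n - 1)"
proof -
  have "cross (\<lambda>y. y * (1 / y)) k = 0" for k
    using cross_cong[of "\<lambda>y. y * (1 / y)" "\<lambda>y. 1" k] by (simp add: cross_const)
  then have "t * (\<alpha> n * (cross (\<lambda>y. 1 / y) (Suc n) - cross (\<lambda>y. 1 / y) n)
      + \<beta> (Suc n) * mean (\<lambda>y. 1 / y) (Suc n) - \<beta> n * mean (\<lambda>y. 1 / y) (n - 1)) = 0"
    using cross_difference[OF laurent_divide[OF laurent_const], of 1 n] by simp
  then show ?thesis
    unfolding a_def b_def by (simp add: algebra_simps)
qed

text \<open>
  The difference of the two sides does not depend on \<open>n\<close>: the four relations \<open>r_sum\<close>,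
  \<open>r_difference\<close>, \<open>b_sum\<close> and \<open>b_difference\<close> make its increment cancel. At \<open>n = 0\<close> everything
  vanishes.
\<close>

lemma b_equation:
  "(2 * r n - lam) * b n = t * r n + \<beta> n * (a n * R (n - 1) + a (n - 1) * R n)"
proof (induction n)
  case 0
  then show ?case by (simp add: r_def b_def cross_0 beta_0)
next
  case (Suc n)
  (* Writing 2 (r' b' - r b) = (r' - r) (b' + b) + (r' + r) (b' - b) brings in the sums and
     differences for which relations are known. *)
  have "((2 * r (Suc n) - lam) * b (Suc n) - t * r (Suc n)
        - \<beta> (Suc n) * (a (Suc n) * R n + a n * R (Suc n)))
      - ((2 * r n - lam) * b n - t * r n - \<beta> n * (a n * R (n - 1) + a (n - 1) * R n))
    = (r (Suc n) - r n) * (b (Suc n) + b n - t) + (r (Suc n) + r n - lam) * (b (Suc n) - b n)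
      - R n * (\<beta> (Suc n) * a (Suc n) - \<beta> n * a (n - 1))
      - a n * (\<beta> (Suc n) * R (Suc n) - \<beta> n * R (n - 1))"
    by (simp add: algebra_simps)
  also have "b (Suc n) + b n - t = - \<alpha> n * a n"
    using b_sum[of n] by simp
  also have "r (Suc n) + r n - lam = a n - \<alpha> n * R n"
    using r_sum[of n] by simp
  also have "\<beta> (Suc n) * a (Suc n) - \<beta> n * a (n - 1) = - \<alpha> n * (b (Suc n) - b n)"
    using b_difference[of n] by simp
  also have "\<beta> (Suc n) * R (Suc n) - \<beta> n * R (n - 1) = b (Suc n) - b n - \<alpha> n * (r (Suc n) - r n)"
    using r_difference[of n] by simp
  finally show ?case
    using Suc.IH by (simp add: algebra_simps)
qed

lemma sing_eq: "sing y = 3 * y\<^sup>2 + (- 1) * dpotential lam t y"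
  by (simp add: sing_def dpotential_def)

text \<open>
  Up to sign and the term \<open>3 * y\<^sup>2\<close>, the singular part is \<open>v'\<close>, whose moments are known from
  integration by parts.
\<close>

lemma R_eq: "R n = 3 * ((\<alpha> n)\<^sup>2 + \<beta> n + \<beta> (Suc n))"
  unfolding R_def sing_eq[abs_def]
  by (simp only: mean_add laurent_mult laurent_const laurent_power laurent_id laurent_dpotential
      mean_cmult mean_square mean_dpotential)

lemma r_eq: "r n = 3 * (\<alpha> n + \<alpha> (n - 1)) * \<beta> n - real n"
  unfolding r_def sing_eq[abs_def]
  by (simp only: cross_add laurent_mult laurent_const laurent_power laurent_id laurent_dpotential
      cross_cmult cross_square cross_dpotential)

lemma R_eq_R_coeff: "R_coeff \<alpha> \<beta> n = R n"
  by (simp add: R_coeff_def R_eq)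

lemma r_eq_r_coeff: "r_coeff \<alpha> \<beta> n = r n"
  by (simp add: r_coeff_def r_eq)

lemma a_eq: "a n = r n + r (n + 1) + \<alpha> n * R n - lam"
  using r_sum[of n] by simp

section \<open>Positivity, and solving for the last coefficient\<close>

lemma mean_nonneg: "(\<And>y. y > 0 \<Longrightarrow> g y \<ge> 0) \<Longrightarrow> mean g n \<ge> 0"
  unfolding mean_def inner_def using h_pos[of n]
  by (auto intro!: divide_nonneg_pos L_nonneg mult_nonneg_nonneg[OF zero_le_square])

text \<open>
  The mean of the nonnegative function \<open>(y - c)\<^sup>2 / y\<close>. For \<open>c = \<alpha> n\<close> this is Jensen's inequality for
  \<open>1 / y\<close>; for small \<open>c > 0\<close> it shows that \<open>\<alpha> n\<close> is positive.
\<close>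

lemma mean_id_mean_inverse: "0 \<le> \<alpha> n - 2 * c + c\<^sup>2 * mean (\<lambda>y. 1 / y) n"
proof -
  have "0 \<le> mean (\<lambda>y. (y - c)\<^sup>2 / y) n"
    by (rule mean_nonneg) auto
  also have "\<dots> = mean (\<lambda>y. (y + (- 2 * c)) + c\<^sup>2 * (1 / y)) n"
    by (rule mean_cong) (simp add: field_simps power2_eq_square)
  also have "\<dots> = \<alpha> n - 2 * c + c\<^sup>2 * mean (\<lambda>y. 1 / y) n"
    by (simp only: mean_add laurent_add laurent_id laurent_const laurent_mult laurent_divide
        mean_cmult mean_const mean_id)
  finally show ?thesis .
qed

lemma alpha_pos: "\<alpha> n > 0"
proof -
  define e where "e = mean (\<lambda>y. 1 / y) n"
  have "e \<ge> 0" unfolding e_def by (rule mean_nonneg) simp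
  (* any c > 0 with c * e < 2 makes 2 * c - c\<^sup>2 * e positive *)
  define c where "c = 1 / (e + 1)"
  have c: "c > 0" "c * e \<le> 1"
    using \<open>e \<ge> 0\<close> by (simp_all add: c_def)
  have "c * (c * e) \<le> c * 1"
    by (intro mult_left_mono) (use c in auto)
  moreover have "0 \<le> \<alpha> n - 2 * c + c * (c * e)"
    using mean_id_mean_inverse[of n c] by (simp add: power2_eq_square e_def mult.assoc)
  ultimately show ?thesis
    using c(1) by linarith
qed

lemma alpha_a_ge: "\<alpha> n * a n \<ge> t"
proof -
  have "0 \<le> \<alpha> n * (\<alpha> n * mean (\<lambda>y. 1 / y) n - 1)"
    using mean_id_mean_inverse[of n "\<alpha> n"] by (simp add: power2_eq_square algebra_simps)
  then have "0 \<le> \<alpha> n * mean (\<lambda>y. 1 / y) n - 1"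
    using alpha_pos[of n] by (simp add: zero_le_mult_iff)
  then have "0 \<le> t * (\<alpha> n * mean (\<lambda>y. 1 / y) n - 1)"
    using t_pos by simp
  then show ?thesis unfolding a_def by (simp add: algebra_simps)
qed

lemma a_pos: "a n > 0"
  using alpha_a_ge[of n] alpha_pos[of n] t_pos by (meson less_le_trans zero_less_mult_pos)

lemma beta_nonneg: "\<beta> n \<ge> 0"
  using beta_pos[of n] beta_0 by (cases n) (auto simp: less_imp_le)

lemma R_ge: "R n \<ge> 3 * (\<alpha> n)\<^sup>2"
  using beta_nonneg[of n] beta_nonneg[of "Suc n"] by (simp add: R_eq)

text \<open>
  If \<open>2 * r n = lam\<close>, then the right-hand side of \<open>b_equation\<close> vanishes. But it is bounded below by
  \<open>t * (lam + n)\<close>, because of \<open>a i \<ge> t / \<alpha> i\<close>, \<open>R j \<ge> 3 * (\<alpha> j)\<^sup>2\<close> and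
  \<open>v\<^sup>2 / u + u\<^sup>2 / v \<ge> u + v\<close>.
\<close>

lemma two_r_neq_lam:
  assumes "n > 0"
  shows "2 * r n \<noteq> lam"
proof
  assume eq: "2 * r n = lam"
  let ?u = "\<alpha> n" and ?v = "\<alpha> (n - 1)"
  have u: "?u > 0" and v: "?v > 0" by (rule alpha_pos)+
  have aR: "a i * R j \<ge> t / \<alpha> i * (3 * (\<alpha> j)\<^sup>2)" for i j
    using alpha_a_ge[of i] alpha_pos[of i] R_ge[of j] t_pos a_pos[of i]
    by (intro mult_mono) (auto simp: field_simps)
  have "(?u + ?v) * (?u * ?v) \<le> ?u ^ 3 + ?v ^ 3"
  proof -
    have "?u ^ 3 + ?v ^ 3 - (?u + ?v) * (?u * ?v) = (?u + ?v) * (?u - ?v)\<^sup>2"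
      by (simp add: power2_eq_square power3_eq_cube algebra_simps)
    moreover have "\<dots> \<ge> 0" using u v by simp
    ultimately show ?thesis by linarith
  qed
  then have "?u + ?v \<le> (?u ^ 3 + ?v ^ 3) / (?u * ?v)"
    using u v by (simp add: pos_le_divide_eq)
  also have "\<dots> = ?v\<^sup>2 / ?u + ?u\<^sup>2 / ?v"
    using u v by (simp add: field_simps power2_eq_square power3_eq_cube)
  finally have "3 * t * (?u + ?v) \<le> 3 * t * (?v\<^sup>2 / ?u + ?u\<^sup>2 / ?v)"
    using t_pos by simp
  also have "\<dots> \<le> a n * R (n - 1) + a (n - 1) * R n"
    using aR[of n "n - 1"] aR[of "n - 1" n] by (simp add: algebra_simps)
  finally have "\<beta> n * (3 * t * (?u + ?v)) \<le> \<beta> n * (a n * R (n - 1) + a (n - 1) * R n)"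
    by (rule mult_left_mono) (rule beta_nonneg)
  moreover have "\<beta> n * (3 * t * (?u + ?v)) = t * (r n + real n)"
    by (simp add: r_eq)
  ultimately have "t * (2 * r n + real n) \<le> t * r n + \<beta> n * (a n * R (n - 1) + a (n - 1) * R n)"
    by (simp add: algebra_simps)
  also have "\<dots> = 0"
    using b_equation[of n] eq by simp
  finally have "t * (lam + real n) \<le> 0"
    by (simp add: eq)
  moreover have "lam + real n > 0"
    using lam assms by linarith
  ultimately show False
    using t_pos by (simp add: mult_le_0_iff)
qed

lemma b_eq:
  "b n = (a n * \<beta> n * R (n - 1) + a (n - 1) * \<beta> n * R n + t * r n) / (2 * r n - lam)"
proof (cases "n = 0")
  case True
  then show ?thesis by (simp add: b_def r_def cross_0 beta_0)
next
  case False
  then have "2 * r n - lam \<noteq> 0"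
    using two_r_neq_lam by simp
  then show ?thesis
    using b_equation[of n] by (simp add: eq_divide_eq algebra_simps)
qed

lemma A_ladder_eq: "A_ladder lam \<alpha> \<beta> n z = mean (kernel z) n"
  by (simp add: A_ladder_def Let_def R_eq_R_coeff r_eq_r_coeff kernel_mean a_eq)

lemma B_ladder_eq: "B_ladder lam t \<alpha> \<beta> n z = cross (kernel z) n"
proof (cases "n = 0")
  case True
  then show ?thesis
    by (simp add: B_ladder_def Let_def r_eq_r_coeff beta_0 r_def cross_0)
next
  case False
  then have "a (n - 1) = r (n - 1) + r n + \<alpha> (n - 1) * R (n - 1) - lam"
    using a_eq[of "n - 1"] by simp
  then show ?thesis
    by (simp add: B_ladder_def Let_def R_eq_R_coeff r_eq_r_coeff kernel_cross b_eq a_eq[of n])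
qed

lemma ladder_pos: "z > 0 \<Longrightarrow> A_ladder lam \<alpha> \<beta> n z > 0"
proof -
  assume "z > 0"
  moreover have "R n \<ge> 0"
    using R_ge[of n] zero_le_power2[of "\<alpha> n"] by linarith
  ultimately show ?thesis
    using alpha_pos[of n] a_pos[of n]
    by (auto simp: A_ladder_eq kernel_mean intro!: add_pos_nonneg)
qed

section \<open>The differential equation\<close>

lemma ladders_differentiable:
  assumes "z > 0"
  shows "A_ladder lam \<alpha> \<beta> n field_differentiable (at z)"
    and "B_ladder lam t \<alpha> \<beta> n field_differentiable (at z)"
  unfolding A_ladder_eq[abs_def] B_ladder_eq[abs_def] kernel_mean kernel_cross
  using assms by (auto intro!: derivative_intros)

text \<open>
  Differentiate the lowering formula, insert the raising formula for \<open>P\<^sub>n\<^sub>-\<^sub>1'\<close>, and express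
  \<open>\<beta>\<^sub>n P\<^sub>n\<^sub>-\<^sub>1\<close> by \<open>P\<^sub>n\<close> and \<open>P\<^sub>n'\<close> through the lowering formula again.
\<close>

lemma differential_equation:
  defines "A \<equiv> A_ladder lam \<alpha> \<beta>" and "B \<equiv> B_ladder lam t \<alpha> \<beta>" and "v' \<equiv> dpotential lam t"
  assumes x: "x > 0"
  shows "poly (pderiv (pderiv (P n))) x - (v' x + deriv (A n) x / A n x) * poly (pderiv (P n)) x
      + (deriv (B n) x - (B n x)\<^sup>2 - v' x * B n x + \<beta> n * A n x * A (n - 1) x
         - deriv (A n) x * B n x / A n x) * poly (P n) x = 0"
proof -
  have lower: "poly (pderiv (P n)) z = \<beta> n * A n z * poly (P (n - 1)) z - B n z * poly (P n) z"
    if "z > 0" for z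
    using lowering[OF that] unfolding A_def B_def A_ladder_eq B_ladder_eq .
  have raise: "\<beta> n * poly (pderiv (P (n - 1))) x
      = \<beta> n * ((B n x + v' x) * poly (P (n - 1)) x - A (n - 1) x * poly (P n) x)"
    using raising[OF x, of n] unfolding A_def B_def v'_def A_ladder_eq B_ladder_eq
    by (cases "n = 0") (auto simp: beta_0)
  have D: "(A n has_real_derivative deriv (A n) x) (at x)" "(B n has_real_derivative deriv (B n) x) (at x)"
    using ladders_differentiable[OF x] unfolding A_def B_def
    by (simp_all add: DERIV_deriv_iff_field_differentiable)
  have "((\<lambda>z. \<beta> n * A n z * poly (P (n - 1)) z - B n z * poly (P n) z) has_real_derivative
      \<beta> n * deriv (A n) x * poly (P (n - 1)) x + A n x * (\<beta> n * poly (pderiv (P (n - 1))) x)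
      - deriv (B n) x * poly (P n) x - B n x * poly (pderiv (P n)) x) (at x)"
    by (auto intro!: derivative_eq_intros D simp: algebra_simps)
  then have "(poly (pderiv (P n)) has_real_derivative
      \<beta> n * deriv (A n) x * poly (P (n - 1)) x + A n x * (\<beta> n * poly (pderiv (P (n - 1))) x)
      - deriv (B n) x * poly (P n) x - B n x * poly (pderiv (P n)) x) (at x)"
    by (rule has_field_derivative_transform_within_open[of _ _ _ "{0<..}"]) (use x lower in auto)
  from DERIV_unique[OF poly_DERIV this]
  have second: "poly (pderiv (pderiv (P n))) x
      = \<beta> n * deriv (A n) x * poly (P (n - 1)) x + A n x * (\<beta> n * poly (pderiv (P (n - 1))) x)
      - deriv (B n) x * poly (P n) x - B n x * poly (pderiv (P n)) x" .
  have A: "A n x \<noteq> 0"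
    using ladder_pos[OF x, of n] unfolding A_def by simp
  define q where "q = \<beta> n * poly (P (n - 1)) x"
  have "A n x * q = poly (pderiv (P n)) x + B n x * poly (P n) x"
    using lower[OF x] by (simp add: q_def algebra_simps)
  then have q: "q = (poly (pderiv (P n)) x + B n x * poly (P n) x) / A n x"
    using A by (simp add: eq_divide_eq mult.commute)
  have "poly (pderiv (pderiv (P n))) x = deriv (A n) x * q
      + ((B n x + v' x) * (A n x * q) - \<beta> n * A n x * A (n - 1) x * poly (P n) x)
      - deriv (B n) x * poly (P n) x - B n x * poly (pderiv (P n)) x"
    unfolding second raise q_def by (simp add: algebra_simps)
  also have "A n x * q = poly (pderiv (P n)) x + B n x * poly (P n) x"
    using A by (simp add: q)
  also have "deriv (A n) x * q = deriv (A n) x / A n x * poly (pderiv (P n)) x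
      + deriv (A n) x * B n x / A n x * poly (P n) x"
    by (simp add: q add_divide_distrib distrib_left)
  finally show ?thesis
    by (simp add: power2_eq_square algebra_simps)
qed

end

theorem theorem2p4:
  fixes lam t x :: real
    and P :: "nat \<Rightarrow> real poly"
    and h \<alpha> \<beta> :: "nat \<Rightarrow> real"
    and n :: nat
  defines "v' \<equiv> deriv (potential lam t)"
    and "p \<equiv> poly (P n)"
    and "A \<equiv> A_ladder lam \<alpha> \<beta>"
    and "B \<equiv> B_ladder lam t \<alpha> \<beta>"
  assumes "lam > -1" and "t > 0"
    and "monic_orthogonal (weight lam t) P h"
    and "recurrence_coeffs P \<alpha> \<beta>"
    and "x > 0"
  shows "v' x = 3 * x\<^sup>2 - lam / x - t / x\<^sup>2 \<and>
    deriv (deriv p) x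
      - (v' x + deriv (A n) x / A n x) * deriv p x
      + (deriv (B n) x - (B n x)\<^sup>2 - v' x * B n x + \<beta> n * A n x * A (n - 1) x
         - deriv (A n) x * B n x / A n x) * p x = 0"
proof -
  interpret semi_classical_polys lam t P h \<alpha> \<beta>
    using assms by unfold_locales auto
  have deriv_poly: "deriv (poly q) = poly (pderiv q)" for q :: "real poly"
    by (intro ext DERIV_imp_deriv poly_DERIV)
  have v': "v' x = dpotential lam t x"
    unfolding v'_def using \<open>x > 0\<close> by (rule deriv_potential)
  show ?thesis
    using differential_equation[OF \<open>x > 0\<close>, of n]
    unfolding v' p_def deriv_poly A_def B_def by (simp add: dpotential_def)
qed
end
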